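(* Let $m,n$ be positive integers with $m\ge 9$ and $n>m+1+\max\{3,\frac{11}{m-8}\}$, and suppose $m-1\nmid n-5$. Then $$r(T_m',T_n'')=r(T_m',T_n''')=r(T_m',T_n^3)=m+n-6.$$
   Context: All graphs are finite simple graphs. For graphs $G_1,G_2$, the Ramsey number $r(G_1,G_2)$ is the smallest positive integer $N$ such that for every graph $G$ on $N$ vertices, either $G$ contains a (not necessarily induced) subgraph isomorphic to $G_1$, or the complement $\overline{G}$ contains a subgraph isomorphic to $G_2$. $T_m'$ is the unique tree on $m$ vertices with maximum degree $m-2$. For $n\ge 6$, on vertex set $\{v_0,\ldots,v_{n-1}\}$: $T_n''$ has edges $v_0v_1,\ldots,v_0v_{n-4},v_1v_{n-3},v_1v_{n-2},v_2v_{n-1}$; $T_n'''$ has edges $v_0v_1,\ldots,v_0v_{n-4},v_1v_{n-3},v_2v_{n-2},v_3v_{n-1}$; $T_n^3$ has edges $v_0v_1,\ldots,v_0v_{n-4},v_{n-4}v_{n-3},v_{n-4}v_{n-2},v_{n-4}v_{n-1}$. *)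

theory Defs
  imports Complex_Main "Graph_Theory.Graph_Theory"
begin

text \<open>
  A finite simple graph is a \<^locale>\<open>pair_graph\<close>: a finite vertex set with a symmetric,
  irreflexive set of ordered pairs. Each edge \<open>uv\<close> is present as both \<open>(u, v)\<close> and \<open>(v, u)\<close>,
  so \<^const>\<open>out_degree\<close> is the degree.
\<close>

definition graph_of :: "'a set \<Rightarrow> ('a \<times> 'a) set \<Rightarrow> 'a pair_pre_digraph" where
  "graph_of V E = \<lparr> pverts = V, parcs = E \<union> E\<inverse> \<rparr>"

definition graph_complement :: "'a pair_pre_digraph \<Rightarrow> 'a pair_pre_digraph" where
  "graph_complement G =
     \<lparr> pverts = pverts G,
       parcs = {(u, v). u \<in> pverts G \<and> v \<in> pverts G \<and> u \<noteq> v \<and> (u, v) \<notin> parcs G} \<rparr>"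

definition contains_copy :: "'a pair_pre_digraph \<Rightarrow> 'b pair_pre_digraph \<Rightarrow> bool" where
  "contains_copy G H \<longleftrightarrow>
     (\<exists>K. pair_graph K \<and> subgraph (with_proj K) (with_proj G) \<and>
          digraph_iso (with_proj K) (with_proj H))"

text \<open>
  Taking the vertices of \<open>G\<close> to be natural numbers is no restriction, since every
  finite graph is isomorphic to one of these.
\<close>

definition ramsey_number :: "'a pair_pre_digraph \<Rightarrow> 'b pair_pre_digraph \<Rightarrow> nat" where
  "ramsey_number G1 G2 =
     (LEAST N. N > 0 \<and>
        (\<forall>G :: nat pair_pre_digraph. pair_graph G \<and> card (pverts G) = N \<longrightarrow>
           contains_copy G G1 \<or> contains_copy (graph_complement G) G2))"

text \<open>
  The library's \<^const>\<open>tree\<close> and \<^const>\<open>forest\<close> are not usable for symmetric digraphs: there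
  the closed walk \<open>a, b, a\<close> counts as a cycle. Cycles of undirected simple graphs
  are those of length at least 3.
\<close>

definition undirected_tree :: "'a pair_pre_digraph \<Rightarrow> bool" where
  "undirected_tree G \<longleftrightarrow>
     pair_graph G \<and> Digraph_Component.connected (with_proj G) \<and>
     \<not> (\<exists>p. pre_digraph.cycle (with_proj G) p \<and> length p \<ge> 3)"

definition max_degree :: "'a pair_pre_digraph \<Rightarrow> nat" where
  "max_degree G = Max (out_degree (with_proj G) ` pverts G)"

text \<open>
  \<open>T\<^sub>m'\<close> is determined by the following property up to isomorphism only, so it is a
  predicate rather than a particular graph.
\<close>

definition is_T1 :: "nat \<Rightarrow> 'a pair_pre_digraph \<Rightarrow> bool" where
  "is_T1 m T \<longleftrightarrow> undirected_tree T \<and> card (pverts T) = m \<and> max_degree T = m - 2"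

text \<open>\<open>T2 n\<close>, \<open>T3 n\<close> and \<open>T_sup3 n\<close> are \<open>T\<^sub>n''\<close>, \<open>T\<^sub>n'''\<close> and \<open>T\<^sub>n\<^sup>3\<close>; the vertex \<open>v\<^sub>i\<close> is \<open>i\<close>.\<close>

definition T2 :: "nat \<Rightarrow> nat pair_pre_digraph" where
  "T2 n = graph_of {0..<n}
     ({(0, i) | i. 1 \<le> i \<and> i \<le> n - 4} \<union> {(1, n - 3), (1, n - 2), (2, n - 1)})"

definition T3 :: "nat \<Rightarrow> nat pair_pre_digraph" where
  "T3 n = graph_of {0..<n}
     ({(0, i) | i. 1 \<le> i \<and> i \<le> n - 4} \<union> {(1, n - 3), (2, n - 2), (3, n - 1)})"

definition T_sup3 :: "nat \<Rightarrow> nat pair_pre_digraph" where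
  "T_sup3 n = graph_of {0..<n}
     ({(0, i) | i. 1 \<le> i \<and> i \<le> n - 4} \<union>
      {(n - 4, n - 3), (n - 4, n - 2), (n - 4, n - 1)})"

lemma pair_graph_graph_of:
  assumes "finite V" "E \<subseteq> V \<times> V" "\<And>v. (v, v) \<notin> E"
  shows "pair_graph (graph_of V E)"
proof -
  have "finite E" using assms finite_subset by blast
  then show ?thesis
    using assms by unfold_locales
      (auto simp: graph_of_def symmetric_def sym_def)
qed

text \<open>The property \<^const>\<open>is_T1\<close> is satisfiable: a star with one edge subdivided has it.\<close>

lemma no_undirected_cycle:
  fixes par :: "'a \<Rightarrow> 'a" and d :: "'a \<Rightarrow> nat"
  assumes *: "\<And>u v. (u, v) \<in> parcs G \<Longrightarrow>
    u = par v \<and> d u < d v \<or> v = par u \<and> d v < d u"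
  shows "\<not> (\<exists>p. pre_digraph.cycle (with_proj G) p \<and> length p \<ge> 3)"
proof
  assume "\<exists>p. pre_digraph.cycle (with_proj G) p \<and> length p \<ge> 3"
  then obtain p u where cyc: "pre_digraph.awalk (with_proj G) u p u"
    "distinct (tl (pawalk_verts u p))" "length p \<ge> 3"
    by (auto simp: pre_digraph.cycle_def awalk_verts_with_proj_eq)
  have sub: "set p \<subseteq> parcs G" and pc: "pcas u p u"
    using cyc(1) by (auto simp: pre_digraph.awalk_def cas_with_proj_eq)
  define w where "w i = pawalk_verts u p ! i" for i
  have len: "length (pawalk_verts a q) = Suc (length q)" for a :: 'a and q
    by (induct q arbitrary: a) auto
  have arc: "q ! i = (pawalk_verts a q ! i, pawalk_verts a q ! Suc i)"
    if "pcas a q b" "i < length q" for a b :: 'a and q i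
    using that
  proof (induct q arbitrary: a i)
    case (Cons e q)
    then show ?case by (cases i; cases q) auto
  qed simp
  have "pawalk_verts a q ! 0 = a" if "pcas a q b" for a b :: 'a and q
    using that by (cases q) auto
  then have w0: "w 0 = u" using pc w_def by auto
  have "pawalk_verts a q ! length q = b" if "pcas a q b" for a b :: 'a and q
    using that by (induct q arbitrary: a) auto
  then have wk: "w (length p) = u" using pc w_def by auto
  let ?k = "length p"
  have inj: "i = j" if "w i = w j" "1 \<le> i" "i \<le> ?k" "1 \<le> j" "j \<le> ?k" for i j
  proof -
    have "i - 1 = j - 1"
      using that cyc(2) len[of u p]
        nth_eq_iff_index_eq[of "tl (pawalk_verts u p)" "i - 1" "j - 1"]
      by (simp add: w_def nth_tl)
    then show ?thesis using that by linarith
  qed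
  have edge: "(w i, w (Suc i)) \<in> parcs G" if "i < ?k" for i
    using arc[OF pc that] sub that nth_mem[OF that] by (auto simp: w_def)
  have "finite {1..?k}" "{1..?k} \<noteq> {}" using cyc(3) by auto
  then obtain i where i: "i \<in> {1..?k}" and max: "\<forall>j\<in>{1..?k}. d (w j) \<le> d (w i)"
    using Max_in[of "(\<lambda>i. d (w i)) ` {1..?k}"] Max_ge[of "(\<lambda>i. d (w i)) ` {1..?k}"]
    by (smt (verit) finite_imageI imageE image_eqI image_is_empty)
  have max': "d (w j) \<le> d (w i)" if "j \<le> ?k" for j
    using bspec[OF max, of j] bspec[OF max, of ?k] that w0 wk cyc(3)
    by (cases "j = 0") simp_all
  have pred: "w (i - 1) = par (w i)"
  proof -
    have "i - 1 < ?k" "Suc (i - 1) = i" using i by auto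
    then show ?thesis using *[OF edge[of "i - 1"]] max'[of "i - 1"] by auto
  qed
  define s where "s = (if i = ?k then 1 else Suc i)"
  have "w s = par (w i)"
  proof (cases "i = ?k")
    case True
    moreover have "0 < ?k" "1 \<le> ?k" using cyc(3) by linarith+
    ultimately show ?thesis
      using *[OF edge[of 0]] max'[of 1] w0 wk by (auto simp: s_def)
  next
    case False
    then show ?thesis
      using *[OF edge[of i]] max'[of "Suc i"] i by (auto simp: s_def)
  qed
  then have eq: "w s = w (i - 1)" using pred by simp
  define r where "r = (if i = 1 then ?k else i - 1)"
  have "w r = w s" using eq w0 wk by (auto simp: r_def)
  then have "r = s" using i cyc(3) by (intro inj) (auto simp: r_def s_def)
  then show False using i cyc(3) by (auto simp: r_def s_def split: if_splits)
qed

lemma is_T1_exists: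
  assumes "m \<ge> 4"
  shows "\<exists>T :: nat pair_pre_digraph. is_T1 m T"
proof
  define E :: "(nat \<times> nat) set" where
    "E = insert (1, m - 1) {(0, i) | i. 1 \<le> i \<and> i \<le> m - 2}"
  let ?T = "graph_of {0..<m} E"
  have pg: "pair_graph ?T"
    using assms by (intro pair_graph_graph_of) (auto simp: E_def)
  interpret pair_graph ?T by (rule pg)
  have arcs: "(u, v) \<in> parcs ?T \<longleftrightarrow>
      u = 1 \<and> v = m - 1 \<or> v = 1 \<and> u = m - 1 \<or>
      u = 0 \<and> 1 \<le> v \<and> v \<le> m - 2 \<or> v = 0 \<and> 1 \<le> u \<and> u \<le> m - 2" for u v
    by (auto simp: graph_of_def E_def)
  have verts: "pverts ?T = {0..<m}"
    by (simp add: graph_of_def)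
  have acyc: "\<not> (\<exists>p. pre_digraph.cycle (with_proj ?T) p \<and> length p \<ge> 3)"
    by (rule no_undirected_cycle[where par = "\<lambda>v. if v = m - 1 then 1 else 0" and d = "\<lambda>v. v"])
      (use assms in \<open>unfold arcs, auto\<close>)
  have r0: "0 \<rightarrow>\<^sup>*\<^bsub>with_proj ?T\<^esub> v \<and> v \<rightarrow>\<^sup>*\<^bsub>with_proj ?T\<^esub> 0" if "v < m" for v
  proof -
    have step: "0 \<rightarrow>\<^sup>*\<^bsub>with_proj ?T\<^esub> v \<and> v \<rightarrow>\<^sup>*\<^bsub>with_proj ?T\<^esub> 0" if "1 \<le> v" "v \<le> m - 2" for v
      using that by (intro conjI adj_in_verts reachable_adjI) (auto simp: arcs)
    consider "v = 0" | "1 \<le> v" "v \<le> m - 2" | "v = m - 1" using \<open>v < m\<close> by linarith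
    then show ?thesis
    proof cases
      case 1
      then show ?thesis using assms by (auto simp: verts)
    next
      case 3
      have "1 \<rightarrow>\<^sup>*\<^bsub>with_proj ?T\<^esub> v" "v \<rightarrow>\<^sup>*\<^bsub>with_proj ?T\<^esub> 1"
        using 3 by (auto intro!: reachable_adjI simp: arcs)
      moreover have "0 \<rightarrow>\<^sup>*\<^bsub>with_proj ?T\<^esub> 1 \<and> 1 \<rightarrow>\<^sup>*\<^bsub>with_proj ?T\<^esub> 0"
        using step[of 1] assms by simp
      ultimately show ?thesis using reachable_trans by blast
    qed (use step in auto)
  qed
  have sc: "strongly_connected (with_proj ?T)"
    unfolding strongly_connected_def
    using r0 assms reachable_trans by (auto simp: verts) blast
  have "mk_symmetric (with_proj ?T) = ?T"
    by (auto simp: mk_symmetric_def graph_of_def)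
  then have conn: "Digraph_Component.connected (with_proj ?T)"
    using sc by (simp add: Digraph_Component.connected_def)
  have out: "out_degree (with_proj ?T) v = card {w. (v, w) \<in> parcs ?T}" for v
  proof -
    have "out_arcs (with_proj ?T) v = Pair v ` {w. (v, w) \<in> parcs ?T}"
      by (auto simp: out_arcs_def)
    then show ?thesis by (simp add: out_degree_def card_image inj_on_def)
  qed
  have "{w. (0, w) \<in> parcs ?T} = {1..m - 2}" using assms by (auto simp: arcs)
  then have d0: "out_degree (with_proj ?T) 0 = m - 2" by (simp add: out)
  have "out_degree (with_proj ?T) v \<le> m - 2" for v
  proof (cases "v = 0")
    case False
    then have "{w. (v, w) \<in> parcs ?T} \<subseteq> {0, if v = 1 then m - 1 else 1}"
      using assms by (auto simp: arcs)
    then have "card {w. (v, w) \<in> parcs ?T} \<le> card {0, if v = 1 then m - 1 else 1}"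
      by (intro card_mono) auto
    also have "\<dots> \<le> m - 2" using assms by (auto simp: card_insert_if)
    finally show ?thesis by (simp add: out)
  qed (simp add: d0)
  then have "max_degree ?T = m - 2"
    unfolding max_degree_def using d0 assms
    by (intro Max_eqI) (auto simp: verts intro!: image_eqI[of _ _ 0])
  then show "is_T1 m ?T"
    using pg conn acyc by (simp add: is_T1_def undirected_tree_def verts)
qed

end

theory Submission
  imports Defs
begin

text \<open>
  A connected graph without \<open>T\<^sub>m'\<close> has maximum degree at most \<open>m - 3\<close>, or exactly \<open>m - 1\<close> vertices,
  or is a star. On \<open>m + n - 6 = (m - 1) + (n - 5)\<close> vertices the divisibility hypothesis prevents
  all components from having \<open>m - 1\<close> vertices. So there is either a star component, or a vertex \<open>v\<close>
  such that \<open>v\<close> and its neighbours have degree at most \<open>m - 3\<close>. In the complement a leaf of the star,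
  respectively \<open>v\<close>, has degree at least \<open>n - 4\<close> and serves as the centre \<open>v\<^sub>0\<close>; since non-central
  vertices have small degree, the three remaining vertices of the tree are attached greedily.

  For the lower bound, an \<open>(m - 3)\<close>-regular graph on \<open>m + n - 7\<close> vertices contains no \<open>T\<^sub>m'\<close>, and its
  complement has degree \<open>n - 5\<close>, too small for the centre of the other trees. When \<open>m\<close> and \<open>n\<close> are both even
  no such graph exists, and the disjoint union of \<open>K\<^sub>m\<^sub>-\<^sub>1\<close> and an \<open>(m - 3)\<close>-regular graph on
  \<open>n - 6\<close> vertices takes its place.
\<close>

section \<open>Copies as injective homomorphisms\<close>

abbreviation nbhd :: "'a pair_pre_digraph \<Rightarrow> 'a \<Rightarrow> 'a set" where
  "nbhd G v \<equiv> parcs G `` {v}"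

lemma pair_graphI:
  assumes "finite (pverts G)" "parcs G \<subseteq> pverts G \<times> pverts G"
    and "\<And>u v. (u, v) \<in> parcs G \<Longrightarrow> (v, u) \<in> parcs G"
    and "\<And>v. (v, v) \<notin> parcs G"
  shows "pair_graph G"
proof -
  have "finite (parcs G)" using assms finite_subset by blast
  then show ?thesis
    using assms by unfold_locales (auto simp: symmetric_def intro: symI)
qed

context
  fixes G :: "'a pair_pre_digraph"
  assumes G: "pair_graph G"
begin

lemma pair_graph_sym: "(u, v) \<in> parcs G \<Longrightarrow> (v, u) \<in> parcs G"
proof -
  interpret pair_graph G by (rule G)
  show "(u, v) \<in> parcs G \<Longrightarrow> (v, u) \<in> parcs G"
    using sym_arcs by (auto simp: symmetric_def dest: symD)
qed

lemma pair_graph_irrefl: "(v, v) \<notin> parcs G"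
proof -
  interpret pair_graph G by (rule G)
  show ?thesis using no_loops' by blast
qed

lemma pair_graph_finite: "finite (pverts G)"
proof -
  interpret pair_graph G by (rule G)
  show ?thesis by (rule pair_finite_verts)
qed

lemma pair_graph_arcs: "parcs G \<subseteq> pverts G \<times> pverts G"
proof -
  interpret pair_graph G by (rule G)
  show ?thesis using in_arcsD1 in_arcsD2 by auto
qed

lemma nbhd_subset: "nbhd G v \<subseteq> pverts G - {v}"
  using pair_graph_arcs pair_graph_irrefl by auto

lemma finite_nbhd: "finite (nbhd G v)"
  using nbhd_subset pair_graph_finite finite_subset by blast

lemma pair_graph_complement: "pair_graph (graph_complement G)"
  using pair_graph_finite pair_graph_sym
  by (intro pair_graphI) (auto simp: graph_complement_def)

lemma nbhd_complement: "v \<in> pverts G \<Longrightarrow> nbhd (graph_complement G) v = pverts G - {v} - nbhd G v"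
  by (auto simp: graph_complement_def)

lemma card_nbhd_complement:
  assumes "v \<in> pverts G"
  shows "card (nbhd (graph_complement G) v) = card (pverts G) - 1 - card (nbhd G v)"
  using assms nbhd_subset[of v] finite_nbhd[of v] pair_graph_finite
  by (simp add: nbhd_complement card_Diff_subset)

text \<open>Connectivity is strong connectivity of the symmetric closure. Since \<open>G\<close> is
  already symmetric, this is reachability in \<open>G\<close> itself, and a walk cannot leave a set
  that is closed under taking neighbours.\<close>

lemma connected_subset_closed:
  assumes conn: "Digraph_Component.connected (with_proj G)"
    and "c \<in> S" "c \<in> pverts G" and closed: "\<And>u. u \<in> S \<Longrightarrow> nbhd G u \<subseteq> S"
  shows "pverts G \<subseteq> S"
proof
  fix v assume "v \<in> pverts G"
  have mk: "mk_symmetric (with_proj G) = G"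
    using pair_graph_sym by (auto simp: mk_symmetric_def intro!: pair_pre_digraph.equality)
  have "c \<rightarrow>\<^sup>*\<^bsub>with_proj G\<^esub> v"
    using conn \<open>v \<in> pverts G\<close> \<open>c \<in> pverts G\<close>
    unfolding Digraph_Component.connected_def strongly_connected_def mk by simp
  then have "(c, v) \<in> (parcs G)\<^sup>*"
    unfolding reachable_def by (auto dest: rtrancl_on_rtranclI)
  then show "v \<in> S"
    by induct (use \<open>c \<in> S\<close> closed in auto)
qed

end

text \<open>The working form of \<open>contains_copy\<close>: constructions produce an injective
  homomorphism rather than a subgraph with an isomorphism. The next two lemmas translate between the
  two.\<close>

definition embeds :: "('a \<Rightarrow> 'b) \<Rightarrow> 'a pair_pre_digraph \<Rightarrow> 'b pair_pre_digraph \<Rightarrow> bool" where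
  "embeds f H G \<longleftrightarrow> inj_on f (pverts H) \<and> f ` pverts H \<subseteq> pverts G \<and>
     (\<forall>x y. (x, y) \<in> parcs H \<longrightarrow> (f x, f y) \<in> parcs G)"

lemma contains_copyI:
  assumes G: "pair_graph G" and H: "pair_graph H" and f: "embeds f H G"
  shows "contains_copy G H"
proof -
  define K where "K = \<lparr> pverts = f ` pverts H, parcs = map_prod f f ` parcs H \<rparr>"
  define h where "h = \<lparr> iso_verts = f, iso_arcs = map_prod f f, iso_head = snd, iso_tail = fst \<rparr>"
  have inj: "inj_on f (pverts H)" using f by (simp add: embeds_def)
  have K: "pair_graph K"
  proof (rule pair_graphI)
    show "finite (pverts K)" using pair_graph_finite[OF H] by (simp add: K_def)
    show "parcs K \<subseteq> pverts K \<times> pverts K" using pair_graph_arcs[OF H] by (auto simp: K_def)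
    show "(v, u) \<in> parcs K" if "(u, v) \<in> parcs K" for u v
      using that pair_graph_sym[OF H] by (force simp: K_def)
    show "(v, v) \<notin> parcs K" for v
      using pair_graph_irrefl[OF H] pair_graph_arcs[OF H] inj by (auto simp: K_def dest: inj_onD)
  qed
  have wf: "wf_digraph (with_proj L)" if "pair_graph L" for L :: "'c pair_pre_digraph"
    using that by (simp add: wf_digraph_wp_iff pair_graph_def pair_digraph_def pair_fin_digraph_def)
  have "subgraph (with_proj K) (with_proj G)"
    unfolding subgraph_def using f wf[OF K] wf[OF G]
    by (auto simp: K_def embeds_def compatible_def)
  moreover have "inj_on (map_prod f f) (parcs H)"
    using map_prod_inj_on[OF inj inj] pair_graph_arcs[OF H] inj_on_subset by blast
  then have "pre_digraph.digraph_isomorphism (with_proj H) h"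
    unfolding pre_digraph.digraph_isomorphism_def using inj wf[OF H] by (simp add: h_def)
  moreover have "with_proj K = app_iso h (with_proj H)"
    by (simp add: app_iso_def h_def K_def with_proj_def)
  ultimately show ?thesis
    unfolding contains_copy_def using K digraph_iso_swap[OF wf[OF H], of "with_proj K"]
    by (metis digraph_iso_def)
qed

lemma contains_copyD:
  assumes "contains_copy G H"
  obtains f where "embeds f H G"
proof -
  obtain K where K: "pair_graph K" "subgraph (with_proj K) (with_proj G)"
    "digraph_iso (with_proj K) (with_proj H)"
    using assms by (auto simp: contains_copy_def)
  have "wf_digraph (with_proj K)" using K(2) by (simp add: subgraph_def)
  from digraph_iso_swap[OF this K(3)] obtain h
    where h: "pre_digraph.digraph_isomorphism (with_proj H) h" "with_proj K = app_iso h (with_proj H)"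
    by (auto simp: digraph_iso_def)
  have eq: "pverts K = iso_verts h ` pverts H" "parcs K = iso_arcs h ` parcs H"
    "iso_tail h = fst" "iso_head h = snd"
    using h(2) by (simp_all add: app_iso_def with_proj_def)
  have "iso_arcs h (x, y) = (iso_verts h x, iso_verts h y)" if "(x, y) \<in> parcs H" for x y
    using h(1) that eq by (force simp: pre_digraph.digraph_isomorphism_def prod_eq_iff)
  then have "embeds (iso_verts h) H G"
    using h(1) K(2) eq
    by (force simp: embeds_def subgraph_def pre_digraph.digraph_isomorphism_def)
  then show thesis by (rule that)
qed

lemma embeds_trans: "embeds f H G \<Longrightarrow> embeds g G L \<Longrightarrow> embeds (g \<circ> f) H L"
  by (auto simp: embeds_def image_subset_iff intro: comp_inj_on inj_on_subset)

lemma card_nbhd_embeds: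
  assumes "embeds f H G" "pair_graph G" "pair_graph H"
  shows "card (nbhd H v) \<le> card (nbhd G (f v))"
proof (rule card_inj_on_le[of f])
  show "inj_on f (nbhd H v)"
    using assms nbhd_subset[of H v] by (auto simp: embeds_def intro: inj_on_subset)
qed (use assms finite_nbhd in \<open>auto simp: embeds_def\<close>)

lemma extend_inj_on:
  assumes "finite I" "finite A" "card I \<le> card A" "P \<subseteq> I" "inj_on h P" "h ` P \<subseteq> A"
  obtains g where "inj_on g I" "g ` I \<subseteq> A" "\<And>i. i \<in> P \<Longrightarrow> g i = h i"
proof -
  have fin: "finite P" using assms finite_subset by blast
  have "card (I - P) \<le> card (A - h ` P)"
    using assms fin by (simp add: card_Diff_subset card_image)
  then obtain k where k: "k ` (I - P) \<subseteq> A - h ` P" "inj_on k (I - P)"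
    using card_le_inj[of "I - P" "A - h ` P"] assms by auto
  let ?g = "\<lambda>i. if i \<in> P then h i else k i"
  have "inj_on ?g I"
    unfolding inj_on_def using k assms(5) by (auto dest: inj_onD)
  moreover have "?g ` I \<subseteq> A" using k assms by auto
  ultimately show thesis by (intro that[of ?g]) auto
qed

section \<open>Embedding the trees\<close>

lemma out_degree_eq_card_nbhd: "out_degree (with_proj G) v = card (nbhd G v)"
proof -
  have "out_arcs (with_proj G) v = Pair v ` nbhd G v"
    by (auto simp: out_arcs_def)
  then show ?thesis by (simp add: out_degree_def card_image inj_on_def)
qed

text \<open>A vertex \<open>c\<close> of degree \<open>m - 2\<close> misses exactly one other vertex
  \<open>w\<close>, which connectivity joins to some neighbour \<open>x\<close> of \<open>c\<close>.
  An edge between two neighbours of \<open>c\<close> would close a triangle, and a second edge at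
  \<open>w\<close> a 4-cycle.\<close>

lemma is_T1_structure:
  assumes T: "is_T1 m T" and m: "m \<ge> 2"
  obtains c x w where "c \<in> pverts T" "pverts T = insert c (insert w (nbhd T c))"
    "w \<noteq> c" "w \<notin> nbhd T c" "x \<in> nbhd T c" "card (nbhd T c) = m - 2"
    "parcs T \<subseteq> {c} \<times> nbhd T c \<union> nbhd T c \<times> {c} \<union> {(x, w), (w, x)}"
proof -
  have pg: "pair_graph T" and conn: "Digraph_Component.connected (with_proj T)"
    and acyc: "\<And>p. pre_digraph.cycle (with_proj T) p \<Longrightarrow> length p < 3"
    and card: "card (pverts T) = m" and deg: "max_degree T = m - 2"
    using T by (auto simp: is_T1_def undirected_tree_def not_le)
  note sym = pair_graph_sym[OF pg] and irrefl = pair_graph_irrefl[OF pg]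
    and arcs = pair_graph_arcs[OF pg]
  have fin: "finite (pverts T)" by (rule pair_graph_finite[OF pg])
  have "pverts T \<noteq> {}" using card m by auto
  then have "m - 2 \<in> (\<lambda>v. card (nbhd T v)) ` pverts T"
    using Max_in[of "(\<lambda>v. card (nbhd T v)) ` pverts T"] deg fin
    unfolding max_degree_def out_degree_eq_card_nbhd by (metis finite_imageI image_is_empty)
  then obtain c where c: "c \<in> pverts T" "card (nbhd T c) = m - 2" by auto
  have "card (pverts T - insert c (nbhd T c)) = 1"
    using c card m fin nbhd_subset[OF pg, of c] finite_nbhd[OF pg, of c] irrefl
    by (subst card_Diff_subset) auto
  then obtain w where w: "pverts T - insert c (nbhd T c) = {w}"
    by (auto simp: card_1_singleton_iff)
  then have V: "pverts T = insert c (insert w (nbhd T c))"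
    using c nbhd_subset[OF pg, of c] by auto
  have "\<exists>x \<in> nbhd T c. (x, w) \<in> parcs T"
  proof (rule ccontr)
    assume neg: "\<not> ?thesis"
    have "nbhd T u \<subseteq> insert c (nbhd T c)" if "u \<in> insert c (nbhd T c)" for u
      using that V arcs neg w by auto
    then have "pverts T \<subseteq> insert c (nbhd T c)"
      by (intro connected_subset_closed[OF pg conn, of c]) (use c in auto)
    then show False using w by auto
  qed
  then obtain x where x: "x \<in> nbhd T c" "(x, w) \<in> parcs T" by blast
  have "(a, b) \<in> {c} \<times> nbhd T c \<union> nbhd T c \<times> {c} \<union> {(x, w), (w, x)}"
    if ab: "(a, b) \<in> parcs T" for a b
  proof -
    note cyc_defs = pre_digraph.cycle_def pre_digraph.awalk_def cas_with_proj_eq awalk_verts_with_proj_eq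
    have tri: False if "(c, a') \<in> parcs T" "(a', b') \<in> parcs T" "(b', c) \<in> parcs T" for a' b'
    proof -
      have "pre_digraph.cycle (with_proj T) [(c, a'), (a', b'), (b', c)]"
        using that c irrefl by (auto simp: cyc_defs)
      from acyc[OF this] show False by simp
    qed
    have quad: "b' = x" if "(w, b') \<in> parcs T" "(b', c) \<in> parcs T" for b'
    proof (rule ccontr)
      assume "b' \<noteq> x"
      then have "pre_digraph.cycle (with_proj T) [(c, x), (x, w), (w, b'), (b', c)]"
        using that c w x irrefl by (auto simp: cyc_defs)
      from acyc[OF this] show False by simp
    qed
    have "a \<in> pverts T" "b \<in> pverts T" using ab arcs by auto
    then consider "a = c" | "b = c" | "a \<in> nbhd T c" "b \<in> nbhd T c"
      | "a = w" "b \<in> nbhd T c" | "b = w" "a \<in> nbhd T c" | "a = w" "b = w"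
      using V by auto
    then show ?thesis
      by cases (use ab sym tri quad irrefl in blast)+
  qed
  then have "parcs T \<subseteq> {c} \<times> nbhd T c \<union> nbhd T c \<times> {c} \<union> {(x, w), (w, x)}"
    by auto
  then show thesis using that[of c w x] c w x V by auto
qed

text \<open>The path \<open>v\<close>, \<open>u\<close>, \<open>y\<close> hosts the centre, the
  subdividing vertex and its leaf. As \<open>y\<close> may itself be adjacent to \<open>v\<close>,
  it is removed before the neighbours of \<open>v\<close> are counted.\<close>

lemma contains_T1:
  assumes T: "is_T1 m T" "m \<ge> 2" and G: "pair_graph G"
    and uv: "u \<in> nbhd G v" "y \<in> nbhd G u" "y \<noteq> v" and card: "m - 2 \<le> card (nbhd G v - {y})"
  shows "contains_copy G T"
proof -
  have pg: "pair_graph T" using T by (simp add: is_T1_def undirected_tree_def)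
  obtain c x w where s: "c \<in> pverts T" "pverts T = insert c (insert w (nbhd T c))"
    "w \<noteq> c" "w \<notin> nbhd T c" "x \<in> nbhd T c" "card (nbhd T c) = m - 2"
    "parcs T \<subseteq> {c} \<times> nbhd T c \<union> nbhd T c \<times> {c} \<union> {(x, w), (w, x)}"
    by (rule is_T1_structure[OF T])
  have "u \<noteq> y" using uv pair_graph_irrefl[OF G] by auto
  then obtain g where g: "inj_on g (nbhd T c)" "g ` nbhd T c \<subseteq> nbhd G v - {y}"
      "\<And>i. i \<in> {x} \<Longrightarrow> g i = (\<lambda>_. u) i"
    using extend_inj_on[of "nbhd T c" "nbhd G v - {y}" "{x}" "\<lambda>_. u"]
      finite_nbhd[OF pg] finite_nbhd[OF G] s card uv by auto
  define f where "f = g(c := v, w := y)"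
  have fc: "f c = v" "f w = y" using s by (auto simp: f_def)
  have c_notin: "c \<notin> nbhd T c" using pair_graph_irrefl[OF pg] by auto
  have fN: "f a = g a" if "a \<in> nbhd T c" for a using that s c_notin by (auto simp: f_def)
  have "inj_on f (nbhd T c)" using g(1) inj_on_cong[of "nbhd T c" f g, OF fN] by blast
  moreover have imf: "f ` nbhd T c \<subseteq> nbhd G v - {y}" using g(2) fN by auto
  ultimately have "inj_on f (pverts T)"
    unfolding s(2) using uv pair_graph_irrefl[OF G] s fc c_notin by (auto simp: inj_on_insert)
  moreover have "f ` pverts T \<subseteq> pverts G"
    unfolding s(2) using imf fc uv pair_graph_arcs[OF G] by auto
  moreover have "(f a, f b) \<in> parcs G" if "(a, b) \<in> parcs T" for a b
  proof -
    have "f x = u" using fN s g by auto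
    then show ?thesis
      using that s(7) imf fc uv pair_graph_sym[OF G] by blast
  qed
  ultimately have "embeds f T G" by (auto simp: embeds_def)
  then show ?thesis by (rule contains_copyI[OF G pg])
qed

text \<open>A common form of the three trees on \<open>n\<close> vertices, which differ only in
  which of the attachment points coincide.\<close>

definition spider :: "nat \<Rightarrow> nat \<Rightarrow> nat \<Rightarrow> nat \<Rightarrow> nat pair_pre_digraph" where
  "spider n p\<^sub>1 p\<^sub>2 p\<^sub>3 = graph_of {0..<n}
     ({(0, i) | i. 1 \<le> i \<and> i \<le> n - 4} \<union> {(p\<^sub>1, n - 3), (p\<^sub>2, n - 2), (p\<^sub>3, n - 1)})"

lemma T2_eq_spider: "T2 n = spider n 1 1 2"
  and T3_eq_spider: "T3 n = spider n 1 2 3"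
  and T_sup3_eq_spider: "T_sup3 n = spider n (n - 4) (n - 4) (n - 4)"
  by (simp_all add: T2_def T3_def T_sup3_def spider_def)

lemma pair_graph_spider:
  assumes "n \<ge> 5" "{p\<^sub>1, p\<^sub>2, p\<^sub>3} \<subseteq> {1..n - 4}"
  shows "pair_graph (spider n p\<^sub>1 p\<^sub>2 p\<^sub>3)"
  unfolding spider_def using assms by (intro pair_graph_graph_of) auto

lemma card_nbhd_spider:
  assumes "n \<ge> 5" "{p\<^sub>1, p\<^sub>2, p\<^sub>3} \<subseteq> {1..n - 4}"
  shows "n - 4 \<le> card (nbhd (spider n p\<^sub>1 p\<^sub>2 p\<^sub>3) 0)"
proof -
  have "{1..n - 4} \<subseteq> nbhd (spider n p\<^sub>1 p\<^sub>2 p\<^sub>3) 0"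
    by (auto simp: spider_def graph_of_def)
  from card_mono[OF finite_nbhd[OF pair_graph_spider[OF assms]] this] show ?thesis by simp
qed

text \<open>Since \<open>h\<close> is a function on the attachment points, equal points share an
  image. The remaining neighbours of the centre are chosen away from the three outer
  vertices.\<close>

lemma contains_spider:
  assumes n: "n \<ge> 5" and p: "{p\<^sub>1, p\<^sub>2, p\<^sub>3} \<subseteq> {1..n - 4}" and H: "pair_graph H"
    and h: "inj_on h {p\<^sub>1, p\<^sub>2, p\<^sub>3}" "h ` {p\<^sub>1, p\<^sub>2, p\<^sub>3} \<subseteq> nbhd H v - {b\<^sub>1, b\<^sub>2, b\<^sub>3}"
    and b: "distinct [v, b\<^sub>1, b\<^sub>2, b\<^sub>3]"
      "(h p\<^sub>1, b\<^sub>1) \<in> parcs H" "(h p\<^sub>2, b\<^sub>2) \<in> parcs H" "(h p\<^sub>3, b\<^sub>3) \<in> parcs H"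
    and card: "n - 4 \<le> card (nbhd H v - {b\<^sub>1, b\<^sub>2, b\<^sub>3})"
  shows "contains_copy H (spider n p\<^sub>1 p\<^sub>2 p\<^sub>3)"
proof -
  let ?A = "nbhd H v - {b\<^sub>1, b\<^sub>2, b\<^sub>3}"
  obtain g where g: "inj_on g {1..n - 4}" "g ` {1..n - 4} \<subseteq> ?A"
      "\<And>i. i \<in> {p\<^sub>1, p\<^sub>2, p\<^sub>3} \<Longrightarrow> g i = h i"
    by (rule extend_inj_on[of "{1..n - 4}" ?A "{p\<^sub>1, p\<^sub>2, p\<^sub>3}" h])
      (use finite_nbhd[OF H] card p h in auto)
  define f where "f = g(0 := v, n - 3 := b\<^sub>1, n - 2 := b\<^sub>2, n - 1 := b\<^sub>3)"
  have fl: "f 0 = v" "f (n - 3) = b\<^sub>1" "f (n - 2) = b\<^sub>2" "f (n - 1) = b\<^sub>3"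
    using n by (auto simp: f_def)
  have fN: "f i = g i" if "i \<in> {1..n - 4}" for i using that n by (auto simp: f_def)
  have V: "{0..<n} = insert 0 (insert (n - 3) (insert (n - 2) (insert (n - 1) {1..n - 4})))"
    using n by auto
  have "inj_on f {1..n - 4}" using g(1) inj_on_cong[of "{1..n - 4}" f g, OF fN] by blast
  moreover have imf: "f ` {1..n - 4} \<subseteq> ?A" using g(2) fN by (auto simp: image_subset_iff)
  moreover have "v \<notin> ?A" using pair_graph_irrefl[OF H] by auto
  ultimately have "inj_on f {0..<n}"
    unfolding V using fl b(1) n by (auto simp: inj_on_insert)
  moreover have "f ` {0..<n} \<subseteq> pverts H"
  proof -
    have "v \<in> pverts H" using h(2) pair_graph_arcs[OF H] by auto
    then show ?thesis
      unfolding V using imf fl b pair_graph_arcs[OF H] by auto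
  qed
  moreover have "(f i, f j) \<in> parcs H" if "(i, j) \<in> parcs (spider n p\<^sub>1 p\<^sub>2 p\<^sub>3)" for i j
  proof -
    have fp: "f p\<^sub>1 = h p\<^sub>1" "f p\<^sub>2 = h p\<^sub>2" "f p\<^sub>3 = h p\<^sub>3" using fN g(3) p by auto
    have f0: "(f 0, f k) \<in> parcs H" if "1 \<le> k" "k \<le> n - 4" for k
      using imf that fl by (auto simp: image_subset_iff)
    define E where "E = {(0, k) | k. 1 \<le> k \<and> k \<le> n - 4} \<union> {(p\<^sub>1, n - 3), (p\<^sub>2, n - 2), (p\<^sub>3, n - 1)}"
    have "(f k, f l) \<in> parcs H" if "(k, l) \<in> E" for k l
    proof -
      from that consider "k = 0" "1 \<le> l" "l \<le> n - 4" | "k = p\<^sub>1" "l = n - 3" | "k = p\<^sub>2" "l = n - 2"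
        | "k = p\<^sub>3" "l = n - 1"
        unfolding E_def by blast
      then show ?thesis by cases (use f0 in blast, simp_all only: fp fl b)
    qed
    moreover have "(i, j) \<in> E \<or> (j, i) \<in> E"
      using that by (simp add: spider_def graph_of_def E_def)
    ultimately show ?thesis using pair_graph_sym[OF H] by blast
  qed
  ultimately have "embeds f (spider n p\<^sub>1 p\<^sub>2 p\<^sub>3) H"
    by (auto simp: embeds_def spider_def graph_of_def)
  then show ?thesis by (rule contains_copyI[OF H pair_graph_spider[OF n p]])
qed

text \<open>Hanging all three \<open>b\<close>'s on \<open>u\<close> gives \<open>T_sup3\<close>.
  For \<open>T2\<close>, \<open>b\<^sub>3\<close> is moved to a fresh common neighbour
  \<open>u\<^sub>3\<close> with \<open>v\<close>; for \<open>T3\<close>, \<open>b\<^sub>2\<close> is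
  also moved, to \<open>u\<^sub>2\<close>.\<close>

lemma contains_three_trees:
  assumes n: "n \<ge> 7" and H: "pair_graph H" and u: "u \<in> nbhd H v"
    and b: "distinct [v, b\<^sub>1, b\<^sub>2, b\<^sub>3]" "{b\<^sub>1, b\<^sub>2, b\<^sub>3} \<subseteq> nbhd H u"
    and five: "\<And>b. b \<in> {b\<^sub>1, b\<^sub>2, b\<^sub>3} \<Longrightarrow> 5 \<le> card (nbhd H v \<inter> nbhd H b)"
    and card: "n - 4 \<le> card (nbhd H v - {b\<^sub>1, b\<^sub>2, b\<^sub>3})"
  shows "contains_copy H (T2 n) \<and> contains_copy H (T3 n) \<and> contains_copy H (T_sup3 n)"
proof -
  note irrefl = pair_graph_irrefl[OF H] and sym = pair_graph_sym[OF H]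
  \<comment> \<open>Five common neighbours leave one outside any four vertices:
    \<open>u\<^sub>2\<close> has four to avoid, while \<open>u\<^sub>3\<close> has only three, so
    one is repeated.\<close>
  have avoid: "\<exists>z. z \<in> nbhd H v \<and> z \<in> nbhd H b \<and> z \<notin> {x\<^sub>1, x\<^sub>2, x\<^sub>3, x\<^sub>4}"
    if "b \<in> {b\<^sub>1, b\<^sub>2, b\<^sub>3}" for b x\<^sub>1 x\<^sub>2 x\<^sub>3 x\<^sub>4
  proof (rule ccontr)
    assume "\<not> ?thesis"
    then have "nbhd H v \<inter> nbhd H b \<subseteq> {x\<^sub>1, x\<^sub>2, x\<^sub>3, x\<^sub>4}" by blast
    then have "card (nbhd H v \<inter> nbhd H b) \<le> card {x\<^sub>1, x\<^sub>2, x\<^sub>3, x\<^sub>4}" by (intro card_mono) auto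
    also have "\<dots> \<le> 4" using card_length[of "[x\<^sub>1, x\<^sub>2, x\<^sub>3, x\<^sub>4]"] by simp
    finally show False using five[OF that] by simp
  qed
  obtain u\<^sub>3 where u\<^sub>3: "u\<^sub>3 \<in> nbhd H v" "u\<^sub>3 \<in> nbhd H b\<^sub>3" "u\<^sub>3 \<notin> {u, b\<^sub>1, b\<^sub>2, b\<^sub>2}"
    using avoid[of b\<^sub>3 u b\<^sub>1 b\<^sub>2 b\<^sub>2] by auto
  obtain u\<^sub>2 where u\<^sub>2: "u\<^sub>2 \<in> nbhd H v" "u\<^sub>2 \<in> nbhd H b\<^sub>2" "u\<^sub>2 \<notin> {u, u\<^sub>3, b\<^sub>1, b\<^sub>3}"
    using avoid[of b\<^sub>2 u u\<^sub>3 b\<^sub>1 b\<^sub>3] by auto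
  have arcs: "(u, b\<^sub>1) \<in> parcs H" "(u, b\<^sub>2) \<in> parcs H" "(u, b\<^sub>3) \<in> parcs H"
    "(u\<^sub>2, b\<^sub>2) \<in> parcs H" "(u\<^sub>3, b\<^sub>3) \<in> parcs H"
    using b u\<^sub>2 u\<^sub>3 sym by auto
  have ne: "u \<notin> {b\<^sub>1, b\<^sub>2, b\<^sub>3}" "u\<^sub>2 \<notin> {b\<^sub>1, b\<^sub>2, b\<^sub>3}" "u\<^sub>3 \<notin> {b\<^sub>1, b\<^sub>2, b\<^sub>3}"
    using arcs u\<^sub>2 u\<^sub>3 irrefl by auto
  have "contains_copy H (spider n 1 1 2)"
    by (rule contains_spider[of _ _ _ _ _ "(\<lambda>_. u)(2 := u\<^sub>3)" v b\<^sub>1 b\<^sub>2 b\<^sub>3])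
      (use n H u u\<^sub>3 b(1) ne arcs card in auto)
  moreover have "contains_copy H (spider n 1 2 3)"
    by (rule contains_spider[of _ _ _ _ _ "(\<lambda>_. u)(2 := u\<^sub>2, 3 := u\<^sub>3)" v b\<^sub>1 b\<^sub>2 b\<^sub>3])
      (use n H u u\<^sub>2 u\<^sub>3 b(1) ne arcs card in auto)
  moreover have "contains_copy H (spider n (n - 4) (n - 4) (n - 4))"
    by (rule contains_spider[of _ _ _ _ _ "\<lambda>_. u" v b\<^sub>1 b\<^sub>2 b\<^sub>3])
      (use n H u b(1) ne arcs card in auto)
  ultimately show ?thesis by (simp only: T2_eq_spider T3_eq_spider T_sup3_eq_spider)
qed

section \<open>The upper bound\<close>

lemma obtain_distinct_list:
  assumes "k \<le> card S"
  obtains xs where "distinct xs" "set xs \<subseteq> S" "length xs = k"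
proof -
  obtain S' where S': "S' \<subseteq> S" "card S' = k" "finite S'"
    using obtain_subset_with_card_n[OF assms] by metis
  obtain xs where "set xs = S'" "distinct xs" using finite_distinct_list[OF \<open>finite S'\<close>] by blast
  then show thesis using S' distinct_card[of xs] by (intro that[of xs]) auto
qed

text \<open>The closed neighbourhoods of the vertices of degree \<open>k\<close> cover the graph in
  blocks of size \<open>k + 1\<close>. Each block is closed under adjacency, so if two of them meet,
  one contains the centre of the other, and equal size makes them equal.\<close>

lemma closed_nbhds_dvd:
  assumes G: "pair_graph G"
    and cover: "\<And>v. v \<in> pverts G \<Longrightarrow> \<exists>x \<in> pverts G. card (nbhd G x) = k \<and> v \<in> insert x (nbhd G x)"
    and closed: "\<And>x y. x \<in> pverts G \<Longrightarrow> card (nbhd G x) = k \<Longrightarrow> y \<in> nbhd G x \<Longrightarrow>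
      nbhd G y \<subseteq> insert x (nbhd G x)"
  shows "Suc k dvd card (pverts G)"
proof -
  define C where "C = (\<lambda>x. insert x (nbhd G x)) ` {x \<in> pverts G. card (nbhd G x) = k}"
  have un: "\<Union>C = pverts G"
    using cover nbhd_subset[OF G] unfolding C_def by blast
  have card_C: "card (insert x (nbhd G x)) = Suc (card (nbhd G x))" for x
    using finite_nbhd[OF G] pair_graph_irrefl[OF G] by simp
  have sub: "insert x' (nbhd G x') = insert x (nbhd G x)"
    if x: "x \<in> pverts G" "card (nbhd G x) = k" and x': "x' \<in> pverts G" "card (nbhd G x') = k"
      and y: "y \<in> insert x (nbhd G x)" "y \<in> insert x' (nbhd G x')" for x x' y
  proof -
    have cl: "nbhd G z \<subseteq> insert x (nbhd G x)" if "z \<in> insert x (nbhd G x)" for z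
      using that closed[OF x] by auto
    have "x' \<in> insert x (nbhd G x)"
      using y cl[OF y(1)] pair_graph_sym[OF G] by blast
    then have "insert x' (nbhd G x') \<subseteq> insert x (nbhd G x)" using cl by blast
    then show ?thesis
      using card_C[of x] card_C[of x'] x x' finite_nbhd[OF G] by (intro card_subset_eq) auto
  qed
  have "Suc k dvd card (\<Union>C)"
  proof (rule dvd_partition)
    show "\<forall>c1\<in>C. \<forall>c2\<in>C. c1 \<noteq> c2 \<longrightarrow> c1 \<inter> c2 = {}"
      unfolding C_def using sub by blast
  qed (use un pair_graph_finite[OF G] card_C in \<open>auto simp: C_def\<close>)
  then show ?thesis by (simp add: un)
qed

lemma three_trees_in_complement:
  assumes m: "m \<ge> 9" and n: "n \<ge> m + 5" and m9: "m = 9 \<Longrightarrow> n \<ge> 16"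
    and ndvd: "\<not> (m - 1) dvd (n - 5)" and T: "is_T1 m T"
    and G: "pair_graph G" and card_G: "card (pverts G) = m + n - 6"
    and free: "\<not> contains_copy G T"
  defines "H \<equiv> graph_complement G"
  shows "contains_copy H (T2 n) \<and> contains_copy H (T3 n) \<and> contains_copy H (T_sup3 n)"
proof -
  note sym = pair_graph_sym[OF G] and irrefl = pair_graph_irrefl[OF G] and fin = pair_graph_finite[OF G]
    and finN = finite_nbhd[OF G]
  have H: "pair_graph H" unfolding H_def by (rule pair_graph_complement[OF G])
  have NH: "nbhd H v = pverts G - {v} - nbhd G v" if "v \<in> pverts G" for v
    unfolding H_def by (rule nbhd_complement[OF G that])
  have inV: "y \<in> pverts G" if "y \<in> nbhd G v" for v y
    using that pair_graph_arcs[OF G] by auto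
  have n7: "n \<ge> 7" using m n by simp
  \<comment> \<open>All that is used of the absence of \<open>T\<close>: a path \<open>v\<close>,
    \<open>u\<close>, \<open>y\<close> bounds the degree of \<open>v\<close>.\<close>
  have second: "card (nbhd G v - {y}) < m - 2"
    if "u \<in> nbhd G v" "y \<in> nbhd G u" "y \<noteq> v" for u v y
    using contains_T1[OF T _ G that] free m by fastforce
  have card_V_minus: "m + n - 6 - length xs \<le> card (pverts G - set xs)" for xs
    using diff_card_le_card_Diff[of "set xs" "pverts G"] card_length[of xs] card_G by simp
  show ?thesis
  proof (cases "\<exists>v. card (nbhd G v) \<ge> m - 1")
    case True
    then obtain c where c: "card (nbhd G c) \<ge> m - 1" by blast
    \<comment> \<open>With at least \<open>m - 1\<close> neighbours at \<open>c\<close>, removing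
      one still leaves \<open>m - 2\<close>, so no path of length two starts at \<open>c\<close>:
      its component is a star.\<close>
    have leaf: "nbhd G v = {c}" if "v \<in> nbhd G c" for v
    proof -
      have "y = c" if "y \<in> nbhd G v" for y
        using second[OF \<open>v \<in> nbhd G c\<close> that] diff_card_le_card_Diff[of "{y}" "nbhd G c"] c by fastforce
      then show ?thesis using that sym by auto
    qed
    \<comment> \<open>Five leaves of the star play all the roles; in the complement each is adjacent
      to everything except itself and \<open>c\<close>.\<close>
    obtain xs where xs: "distinct xs" "set xs \<subseteq> nbhd G c" "length xs = 5"
      by (rule obtain_distinct_list[of 5 "nbhd G c"]) (use c m in auto)
    then obtain v u b\<^sub>1 b\<^sub>2 b\<^sub>3 where "xs = [v, u, b\<^sub>1, b\<^sub>2, b\<^sub>3]"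
      by (auto simp: eval_nat_numeral length_Suc_conv)
    then have d: "distinct [v, u, b\<^sub>1, b\<^sub>2, b\<^sub>3]" and sub: "{v, u, b\<^sub>1, b\<^sub>2, b\<^sub>3} \<subseteq> nbhd G c"
      using xs by auto
    have NL: "nbhd H x = pverts G - {x, c}" if "x \<in> nbhd G c" for x
      using NH[OF inV[OF that]] leaf[OF that] by auto
    have cne: "c \<notin> {v, u, b\<^sub>1, b\<^sub>2, b\<^sub>3}" using sub irrefl by auto
    show ?thesis
    proof (rule contains_three_trees[OF n7 H])
      show "5 \<le> card (nbhd H v \<inter> nbhd H b)" if "b \<in> {b\<^sub>1, b\<^sub>2, b\<^sub>3}" for b
      proof -
        have "nbhd H v \<inter> nbhd H b = pverts G - set [v, c, b]"
          using NL that sub by auto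
        then show ?thesis using card_V_minus[of "[v, c, b]"] m n by simp
      qed
      have "nbhd H v - {b\<^sub>1, b\<^sub>2, b\<^sub>3} = pverts G - set [v, c, b\<^sub>1, b\<^sub>2, b\<^sub>3]"
        using NL sub by auto
      then show "n - 4 \<le> card (nbhd H v - {b\<^sub>1, b\<^sub>2, b\<^sub>3})"
        using card_V_minus[of "[v, c, b\<^sub>1, b\<^sub>2, b\<^sub>3]"] m n by simp
    next
      show "u \<in> nbhd H v" using NL[of v] d sub inV[of u c] cne by auto
      show "{b\<^sub>1, b\<^sub>2, b\<^sub>3} \<subseteq> nbhd H u"
        using NL[of u] d sub inV[of _ c] cne by auto
    qed (use d in simp)
  next
    case False
    have deg: "card (nbhd G v) \<le> m - 2" for v
    proof -
      have "\<not> m - 1 \<le> card (nbhd G v)" using False by blast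
      then show ?thesis by linarith
    qed
    \<comment> \<open>A vertex \<open>z\<close> outside the closed neighbourhood of \<open>x\<close>
      is not among its \<open>m - 2\<close> neighbours, so removing it costs nothing and
      \<open>second\<close> is violated.\<close>
    have closed: "nbhd G y \<subseteq> insert x (nbhd G x)"
      if "card (nbhd G x) = m - 2" "y \<in> nbhd G x" for x y
    proof
      fix z assume z: "z \<in> nbhd G y"
      show "z \<in> insert x (nbhd G x)"
        using second[OF that(2) z] that(1) by (cases "z \<in> nbhd G x") auto
    qed
    \<comment> \<open>Otherwise every vertex is in the closed neighbourhood of a vertex of degree
      \<open>m - 2\<close>. Then \<open>m - 1\<close> divides
      \<open>m + n - 6 = (m - 1) + (n - 5)\<close>, hence \<open>n - 5\<close>.\<close>
    have "\<exists>v \<in> pverts G. card (nbhd G v) \<le> m - 3 \<and> (\<forall>b \<in> nbhd G v. card (nbhd G b) \<le> m - 3)"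
    proof (rule ccontr)
      assume neg: "\<not> ?thesis"
      have "Suc (m - 2) dvd card (pverts G)"
      proof (rule closed_nbhds_dvd[OF G])
        fix v assume v: "v \<in> pverts G"
        have eq: "card (nbhd G x) = m - 2" if "\<not> card (nbhd G x) \<le> m - 3" for x
          using that deg[of x] by linarith
        show "\<exists>x \<in> pverts G. card (nbhd G x) = m - 2 \<and> v \<in> insert x (nbhd G x)"
        proof (cases "card (nbhd G v) \<le> m - 3")
          case True
          then obtain b where "b \<in> nbhd G v" "\<not> card (nbhd G b) \<le> m - 3" using neg v by blast
          then show ?thesis using eq inV sym by blast
        qed (use v eq in blast)
      qed (rule closed)
      moreover have "Suc (m - 2) = m - 1" "card (pverts G) = (m - 1) + (n - 5)"
        using m n card_G by auto
      ultimately show False using ndvd by (simp only: dvd_add_triv_left_iff)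
    qed
    then obtain v where v: "v \<in> pverts G" and dv: "card (nbhd G v) \<le> m - 3"
      and dN: "\<And>b. b \<in> nbhd G v \<Longrightarrow> card (nbhd G b) \<le> m - 3"
      by blast
    define C where "C = nbhd H v"
    have C: "C = pverts G - {v} - nbhd G v" using NH[OF v] by (simp add: C_def)
    have finC: "finite C" using C fin by simp
    have card_C: "card C = m + n - 7 - card (nbhd G v)"
      unfolding C_def H_def card_nbhd_complement[OF G v] using card_G by simp
    show ?thesis
    \<comment> \<open>In the first case \<open>C\<close> has at least \<open>n - 1\<close> vertices,
      so the three \<open>b\<close>'s may be taken from \<open>C\<close> with \<open>n - 4\<close>
      to spare. Each keeps at least \<open>(n - 1) - (m - 1) \<ge> 5\<close> neighbours in
      \<open>C\<close>.\<close>
    proof (cases "card (nbhd G v) \<le> m - 6")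
      case True
      have five: "5 \<le> card (C \<inter> nbhd H b)" if "b \<in> C" for b
      proof -
        have "C \<inter> nbhd H b = C - insert b (nbhd G b)"
          using that C NH[of b] by auto
        moreover have "card (insert b (nbhd G b)) \<le> m - 1"
          using deg[of b] m card_insert_le_m1[of "m - 1" "nbhd G b" b] by linarith
        ultimately show ?thesis
          using diff_card_le_card_Diff[of "insert b (nbhd G b)" C] finN card_C True m n by simp
      qed
      have "C \<noteq> {}" using card_C True m n by auto
      then obtain u where u: "u \<in> C" by auto
      obtain xs where xs: "distinct xs" "set xs \<subseteq> C \<inter> nbhd H u" "length xs = 3"
        by (rule obtain_distinct_list[of 3 "C \<inter> nbhd H u"]) (use five[OF u] in auto)
      then obtain b\<^sub>1 b\<^sub>2 b\<^sub>3 where eq: "xs = [b\<^sub>1, b\<^sub>2, b\<^sub>3]"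
        by (auto simp: eval_nat_numeral length_Suc_conv)
      show ?thesis
      proof (rule contains_three_trees[OF n7 H])
        show "n - 4 \<le> card (nbhd H v - {b\<^sub>1, b\<^sub>2, b\<^sub>3})"
          using diff_card_le_card_Diff[of "set xs" C] card_length[of xs] xs(3) card_C True m n
          by (simp add: eq C_def)
        show "distinct [v, b\<^sub>1, b\<^sub>2, b\<^sub>3]" using xs C by (auto simp: eq)
      qed (use u xs five in \<open>auto simp: eq C_def\<close>)
    next
      case False
      \<comment> \<open>Now \<open>C\<close> is only known to have \<open>n - 4\<close> vertices, so
        the \<open>b\<close>'s are sought among the neighbours of \<open>v\<close> in
        \<open>G\<close>, outside \<open>C\<close>. One edge at \<open>b\<close> goes to
        \<open>v\<close>, so at most \<open>m - 4\<close> go to \<open>C\<close>, which leaves at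
        least \<open>n - m \<ge> 5\<close> non-neighbours there.\<close>
      have five: "5 \<le> card (C \<inter> nbhd H b)" and few: "card {u \<in> C. (u, b) \<in> parcs G} \<le> m - 4"
        if b: "b \<in> nbhd G v" for b
      proof -
        have cardb: "card (nbhd G b - {v}) \<le> m - 4"
          using dN[OF b] sym[of v b] b finN[of b] by (simp add: card_Diff_singleton)
        have "C \<inter> nbhd H b = C - (nbhd G b - {v})"
          using that C NH[OF inV[OF b]] by auto
        then show "5 \<le> card (C \<inter> nbhd H b)"
          using diff_card_le_card_Diff[of "nbhd G b - {v}" C] finN cardb card_C dv m n by simp
        have "card {u \<in> C. (u, b) \<in> parcs G} \<le> card (nbhd G b - {v})"
          using finN C sym by (intro card_mono) auto
        then show "card {u \<in> C. (u, b) \<in> parcs G} \<le> m - 4" using cardb by simp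
      qed
      \<comment> \<open>Double counting of the edges of \<open>G\<close> between \<open>C\<close>
        and the neighbours of \<open>v\<close>: if the claim fails, each \<open>u\<close> in
        \<open>C\<close> misses at most two of these neighbours.\<close>
      have "\<exists>u \<in> C. 3 \<le> card (nbhd G v \<inter> nbhd H u)"
      proof (rule ccontr)
        assume neg: "\<not> ?thesis"
        have many: "card (nbhd G v) - 2 \<le> card {b \<in> nbhd G v. (u, b) \<in> parcs G}" if u: "u \<in> C" for u
        proof -
          have "u \<in> pverts G" using u C by simp
          have "{b \<in> nbhd G v. (u, b) \<in> parcs G} = nbhd G v - (nbhd G v \<inter> nbhd H u)"
            using u C NH[OF \<open>u \<in> pverts G\<close>] inV by auto
          moreover have "card (nbhd G v \<inter> nbhd H u) \<le> 2" using neg u by fastforce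
          ultimately show ?thesis
            using diff_card_le_card_Diff[of "nbhd G v \<inter> nbhd H u" "nbhd G v"] finN by simp
        qed
        define e where "e = card (nbhd G v) - 2"
        have e: "card (nbhd G v) = e + 2" "e + 7 \<ge> m" using False m by (auto simp: e_def)
        have "card C * e = (\<Sum>u\<in>C. e)" by simp
        also have "\<dots> \<le> (\<Sum>u\<in>C. card {b \<in> nbhd G v. (u, b) \<in> parcs G})"
          unfolding e_def by (intro sum_mono many)
        also have "\<dots> = (\<Sum>b\<in>nbhd G v. card {u \<in> C. (u, b) \<in> parcs G})"
          by (intro sum_multicount_gen) (use finC finN in auto)
        also have "\<dots> \<le> (\<Sum>b\<in>nbhd G v. m - 4)" by (intro sum_mono few)
        finally have le: "card C * e \<le> (e + 2) * (m - 4)" using e by simp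
        have nC: "n - 4 \<le> card C" using card_C dv m n by simp
        show False
        proof (cases "m = 9")
          case True
          \<comment> \<open>From \<open>n \<ge> 16\<close>, \<open>C\<close> has at least 12
            vertices, so \<open>7 * e \<le> 10\<close>, against \<open>e \<ge> 2\<close>.\<close>
          then have "12 * e \<le> card C * e" using nC m9 by (intro mult_right_mono) auto
          then have "12 * e \<le> (e + 2) * (m - 4)" using le by (rule le_trans)
          then show False using True e by simp
        next
          case m9: False
          \<comment> \<open>Here \<open>card C \<ge> n - 4 \<ge> m + 1\<close> yields
            \<open>5 * e \<le> 2 * (m - 4)\<close>. With \<open>e \<ge> m - 7\<close> this forces
            \<open>m \<le> 9\<close>.\<close>
          have "(m + 1) * e \<le> card C * e" using nC n by (intro mult_right_mono) auto
          then have "(m + 1) * e \<le> (e + 2) * (m - 4)" using le by simp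
          moreover obtain k where k: "m = k + 4" using m le_Suc_ex[of 4 m] by auto
          ultimately have "5 * e \<le> 2 * k" by (simp add: algebra_simps)
          then show False using e k m m9 by simp
        qed
      qed
      then obtain u where u: "u \<in> C" "3 \<le> card (nbhd G v \<inter> nbhd H u)" by blast
      obtain xs where xs: "distinct xs" "set xs \<subseteq> nbhd G v \<inter> nbhd H u" "length xs = 3"
        by (rule obtain_distinct_list[OF u(2)])
      then obtain b\<^sub>1 b\<^sub>2 b\<^sub>3 where eq: "xs = [b\<^sub>1, b\<^sub>2, b\<^sub>3]"
        by (auto simp: eval_nat_numeral length_Suc_conv)
      show ?thesis
      proof (rule contains_three_trees[OF n7 H])
        have "nbhd H v - {b\<^sub>1, b\<^sub>2, b\<^sub>3} = C" using xs(2) C by (auto simp: eq C_def)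
        then show "n - 4 \<le> card (nbhd H v - {b\<^sub>1, b\<^sub>2, b\<^sub>3})"
          using card_C dv m n by simp
        show "distinct [v, b\<^sub>1, b\<^sub>2, b\<^sub>3]" using xs irrefl by (auto simp: eq)
      qed (use u xs five in \<open>auto simp: eq C_def\<close>)
    qed
  qed
qed

section \<open>The lower bound\<close>

text \<open>A circulant graph: join \<open>i\<close> to the \<open>d div 2\<close> nearest residues
  on either side and, for odd \<open>d\<close>, to the antipode. The antipode exists because
  \<open>k\<close> is then even.\<close>

lemma ex_regular_relation:
  assumes dk: "d < k" and ev: "even (d * k)"
  obtains E :: "nat rel" where "E \<subseteq> {0..<k} \<times> {0..<k}" "\<And>i j. (i, j) \<in> E \<Longrightarrow> (j, i) \<in> E"
    "\<And>i. (i, i) \<notin> E" "\<And>i. i < k \<Longrightarrow> card (E `` {i}) = d"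
proof -
  \<comment> \<open>the connection set of a circulant graph\<close>
  define S where "S = {1..d div 2} \<union> {k - d div 2..<k} \<union> (if odd d then {k div 2} else {})"
  have S: "S \<subseteq> {1..<k}" using dk ev by (auto simp: S_def elim!: evenE oddE)
  have S_sym: "k - s \<in> S" if "s \<in> S" for s
    using that dk ev by (auto simp: S_def elim!: evenE oddE split: if_splits)
  have card_S: "card S = d"
  proof -
    have "card ({1..d div 2} \<union> {k - d div 2..<k}) = 2 * (d div 2)"
      using dk by (subst card_Un_disjoint) auto
    moreover have "k div 2 \<notin> {1..d div 2} \<union> {k - d div 2..<k}" if "odd d"
      using that dk ev by (auto elim!: evenE oddE)
    ultimately show ?thesis by (auto simp: S_def)
  qed
  \<comment> \<open>Testing the absolute difference avoids residues; it agrees with the circulant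
    relation because \<open>S\<close> is closed under \<open>s\<close> to
    \<open>k - s\<close>.\<close>
  define E where "E = {(i, j). i < k \<and> j < k \<and> (i < j \<and> j - i \<in> S \<or> j < i \<and> i - j \<in> S)}"
  have "card (E `` {i}) = d" if i: "i < k" for i
  proof -
    \<comment> \<open>Addition of \<open>i\<close> modulo \<open>k\<close>, which maps
      \<open>S\<close> bijectively onto the neighbours of \<open>i\<close>.\<close>
    let ?g = "\<lambda>s. if i + s < k then i + s else i + s - k"
    have "j \<in> ?g ` S" if "j \<in> E `` {i}" for j
    proof (cases "i < j")
      case True
      then show ?thesis using that by (intro image_eqI[of _ _ "j - i"]) (auto simp: E_def)
    next
      case False
      then have "k + j - i \<in> S" "j < i" using that S_sym[of "i - j"] by (auto simp: E_def)
      then show ?thesis using i by (intro image_eqI[of _ _ "k + j - i"]) auto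
    qed
    moreover have "?g s \<in> E `` {i}" if s: "s \<in> S" for s
    proof (cases "i + s < k")
      case False
      moreover have "i - (i + s - k) = k - s" using s S i False by auto
      ultimately show ?thesis using s S i S_sym[OF s] by (auto simp: E_def)
    qed (use s S i in \<open>auto simp: E_def\<close>)
    ultimately have "E `` {i} = ?g ` S" by blast
    moreover have "inj_on ?g S"
      using S i by (auto simp: inj_on_def subset_iff split: if_splits)
    ultimately show ?thesis using card_image[of ?g S] card_S by (simp only:)
  qed
  then show thesis by (intro that[of E]) (auto simp: E_def)
qed

text \<open>The set \<open>Q\<close> records the possible clique component, so that both parities
  share one description: \<open>Q\<close> is empty for the regular graph and the vertex set of the
  clique otherwise.\<close>

lemma ex_lower_bound_graph:
  assumes m: "m \<ge> 3" and n: "n \<ge> m + 4"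
  obtains G :: "nat pair_pre_digraph" and Q where "pair_graph G" "card (pverts G) = m + n - 7"
    "finite Q" "card Q < m" "\<And>v. v \<in> Q \<Longrightarrow> nbhd G v \<subseteq> Q"
    "\<And>v. v \<in> pverts G - Q \<Longrightarrow> card (nbhd G v) = m - 3"
    "\<And>v. v \<in> pverts G \<Longrightarrow> m - 3 \<le> card (nbhd G v)"
proof (cases "even m \<and> even n")
  case False
  have "even ((m - 3) * (m + n - 7))" using False m n by auto
  then obtain E :: "nat rel" where E: "E \<subseteq> {0..<m + n - 7} \<times> {0..<m + n - 7}"
    "\<And>i j. (i, j) \<in> E \<Longrightarrow> (j, i) \<in> E" "\<And>i. (i, i) \<notin> E"
    "\<And>i. i < m + n - 7 \<Longrightarrow> card (E `` {i}) = m - 3"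
    by (rule ex_regular_relation[rotated]) (use m n in auto)
  have "pair_graph \<lparr> pverts = {0..<m + n - 7}, parcs = E \<rparr>"
    using E by (intro pair_graphI) auto
  then show thesis
    by (rule that[of _ "{}"]) (use E m in auto)
next
  case True
  \<comment> \<open>The clique takes \<open>m - 1\<close> of the \<open>m + n - 7\<close> vertices
    and leaves \<open>n - 6\<close>, an even number greater than \<open>m - 3\<close>.\<close>
  have "even ((m - 3) * (n - 6))" using True n m by auto
  then obtain E :: "nat rel" where E: "E \<subseteq> {0..<n - 6} \<times> {0..<n - 6}"
    "\<And>i j. (i, j) \<in> E \<Longrightarrow> (j, i) \<in> E" "\<And>i. (i, i) \<notin> E"
    "\<And>i. i < n - 6 \<Longrightarrow> card (E `` {i}) = m - 3"
    by (rule ex_regular_relation[rotated]) (use m n in auto)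
  define Q where "Q = {n - 6..<m + n - 7}"
  define G where "G = \<lparr> pverts = {0..<m + n - 7}, parcs = E \<union> {(i, j). i \<in> Q \<and> j \<in> Q \<and> i \<noteq> j} \<rparr>"
  have card_Q: "card Q = m - 1" using m n by (simp add: Q_def)
  have NE: "nbhd G v = E `` {v}" if "v < n - 6" for v
    using that by (auto simp: G_def Q_def)
  have NQ: "nbhd G v = Q - {v}" if "v \<in> Q" for v
    using that E(1) by (auto simp: G_def Q_def)
  have "pair_graph G"
    using E(1-3) m n by (intro pair_graphI) (auto simp: G_def Q_def)
  moreover have "v < n - 6" if "v \<in> pverts G - Q" for v
    using that by (auto simp: G_def Q_def)
  moreover have "m - 3 \<le> card (nbhd G v)" if "v \<in> Q" for v
    using that card_Q by (simp add: NQ[OF that] card_Diff_singleton)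
  ultimately show thesis
  proof (intro that[of G Q])
    show "card (pverts G) = m + n - 7" by (simp add: G_def)
    show "finite Q" by (simp add: Q_def)
    show "card Q < m" using card_Q m by simp
  qed (use NE NQ E(4) in \<open>(fastforce | metis Diff_iff order_refl)+\<close>)
qed

text \<open>The centre of a copy needs degree at least \<open>m - 2\<close>, so it lies in
  \<open>Q\<close>. Connectivity then confines all \<open>m\<close> vertices to \<open>Q\<close>,
  which is too small.\<close>

lemma lower_bound_graph_T1_free:
  assumes G: "pair_graph G" and T: "is_T1 m T" "m \<ge> 3"
    and Q: "finite Q" "card Q < m" "\<And>v. v \<in> Q \<Longrightarrow> nbhd G v \<subseteq> Q"
    and deg: "\<And>v. v \<in> pverts G - Q \<Longrightarrow> card (nbhd G v) = m - 3"
  shows "\<not> contains_copy G T"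
proof
  assume "contains_copy G T"
  then obtain f where f: "embeds f T G" by (rule contains_copyD)
  have pg: "pair_graph T" and conn: "Digraph_Component.connected (with_proj T)"
    and card_T: "card (pverts T) = m"
    using T by (auto simp: is_T1_def undirected_tree_def)
  obtain c where c: "c \<in> pverts T" "card (nbhd T c) = m - 2"
    by (rule is_T1_structure[OF T(1)]) (use T in auto)
  have "m - 2 \<le> card (nbhd G (f c))" using card_nbhd_embeds[OF f G pg, of c] c by simp
  \<comment> \<open>By \<open>m \<ge> 3\<close> the truncated differences \<open>m - 2\<close> and
    \<open>m - 3\<close> are distinct.\<close>
  then have "card (nbhd G (f c)) \<noteq> m - 3" using T(2) by linarith
  then have "f c \<in> Q" using deg[of "f c"] f c by (auto simp: embeds_def image_subset_iff)
  then have "pverts T \<subseteq> {x \<in> pverts T. f x \<in> Q}"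
    using f Q(3) pair_graph_arcs[OF pg] c
    by (intro connected_subset_closed[OF pg conn, of c]) (auto simp: embeds_def subset_iff)
  then have "card (pverts T) \<le> card Q"
    using f Q(1) by (intro card_inj_on_le[of f]) (auto simp: embeds_def)
  then show False using card_T Q(2) by simp
qed

text \<open>One counterexample on \<open>N - 1\<close> vertices excludes every smaller
  \<open>M\<close> as well: its induced subgraph on \<open>M\<close> vertices and the complement of
  that subgraph embed in \<open>G\<close> and its complement.\<close>

lemma ramsey_number_eqI:
  assumes "N > 0" and pg: "pair_graph G\<^sub>1" "pair_graph G\<^sub>2"
    and upper: "\<And>G :: nat pair_pre_digraph. pair_graph G \<Longrightarrow> card (pverts G) = N \<Longrightarrow>
      contains_copy G G\<^sub>1 \<or> contains_copy (graph_complement G) G\<^sub>2"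
    and G: "pair_graph (G :: nat pair_pre_digraph)" "card (pverts G) = N - 1"
      "\<not> contains_copy G G\<^sub>1" "\<not> contains_copy (graph_complement G) G\<^sub>2"
  shows "ramsey_number G\<^sub>1 G\<^sub>2 = N"
  unfolding ramsey_number_def
proof (rule Least_equality, goal_cases)
  case 1
  then show ?case using \<open>N > 0\<close> upper by blast
next
  case (2 M)
  show ?case
  proof (rule ccontr)
    assume "\<not> N \<le> M"
    then have "M \<le> card (pverts G)" using G by simp
    then obtain W where W: "W \<subseteq> pverts G" "card W = M" by (meson obtain_subset_with_card_n)
    define F where "F = \<lparr> pverts = W, parcs = parcs G \<inter> W \<times> W \<rparr>"
    have F: "pair_graph F"
      using W pair_graph_finite[OF G(1)] pair_graph_sym[OF G(1)] pair_graph_irrefl[OF G(1)]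
      by (intro pair_graphI) (auto simp: F_def intro: finite_subset)
    have emb: "embeds (\<lambda>x. x) F G" "embeds (\<lambda>x. x) (graph_complement F) (graph_complement G)"
      using W by (auto simp: embeds_def F_def graph_complement_def)
    have mono: "contains_copy L' K" if "contains_copy L K" "embeds (\<lambda>x. x) L L'" "pair_graph L'" "pair_graph K"
      for L L' :: "nat pair_pre_digraph" and K :: "'c pair_pre_digraph"
      using that by (meson contains_copyD contains_copyI embeds_trans)
    have "contains_copy F G\<^sub>1 \<or> contains_copy (graph_complement F) G\<^sub>2"
      using 2 F W by (auto simp: F_def)
    then show False
      using mono[OF _ emb(1) G(1) pg(1)] mono[OF _ emb(2) pair_graph_complement[OF G(1)] pg(2)] G(3,4)
      by blast
  qed
qed

section \<open>The Ramsey numbers\<close>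

theorem theorem5p2:
  fixes m n :: nat and T :: "'a pair_pre_digraph"
  assumes "m \<ge> 9"
    and "real n > real m + 1 + max 3 (11 / (real m - 8))"
    and "\<not> (m - 1) dvd (n - 5)"
    and "is_T1 m T"
  shows "ramsey_number T (T2 n) = ramsey_number T (T3 n)
    \<and> ramsey_number T (T3 n) = ramsey_number T (T_sup3 n)
    \<and> ramsey_number T (T_sup3 n) = m + n - 6"
proof -
  have "real n > real m + 4" using assms(2) by linarith
  \<comment> \<open>The maximum is at least 3, and at \<open>m = 9\<close> it equals 11. The special
    bound for \<open>m = 9\<close> feeds the double count of the upper bound.\<close>
  then have n: "n \<ge> m + 5" by linarith
  have n16: "n \<ge> 16" if "m = 9" using assms(2) that by simp
  have T: "pair_graph T" using assms(4) by (simp add: is_T1_def undirected_tree_def)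
  obtain G :: "nat pair_pre_digraph" and Q where G: "pair_graph G" "card (pverts G) = m + n - 7"
    and Q: "finite Q" "card Q < m" "\<And>v. v \<in> Q \<Longrightarrow> nbhd G v \<subseteq> Q"
      "\<And>v. v \<in> pverts G - Q \<Longrightarrow> card (nbhd G v) = m - 3"
    and deg: "\<And>v. v \<in> pverts G \<Longrightarrow> m - 3 \<le> card (nbhd G v)"
    by (rule ex_lower_bound_graph[of m n]) (use assms(1) n in auto)
  have free: "\<not> contains_copy G T"
    by (rule lower_bound_graph_T1_free[OF G(1) assms(4) _ Q]) (use assms(1) in auto)
  have ramsey: "ramsey_number T (spider n p\<^sub>1 p\<^sub>2 p\<^sub>3) = m + n - 6"
    if p: "{p\<^sub>1, p\<^sub>2, p\<^sub>3} \<subseteq> {1..n - 4}"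
      and upper: "\<And>G :: nat pair_pre_digraph. pair_graph G \<Longrightarrow> card (pverts G) = m + n - 6 \<Longrightarrow>
        contains_copy G T \<or> contains_copy (graph_complement G) (spider n p\<^sub>1 p\<^sub>2 p\<^sub>3)"
    for p\<^sub>1 p\<^sub>2 p\<^sub>3
  proof (rule ramsey_number_eqI[OF _ T _ upper G(1) _ free])
    have n5: "n \<ge> 5" using n by simp
    show S: "pair_graph (spider n p\<^sub>1 p\<^sub>2 p\<^sub>3)" by (rule pair_graph_spider[OF n5 p])
    show "\<not> contains_copy (graph_complement G) (spider n p\<^sub>1 p\<^sub>2 p\<^sub>3)"
    proof
      assume "contains_copy (graph_complement G) (spider n p\<^sub>1 p\<^sub>2 p\<^sub>3)"
      then obtain f where f: "embeds f (spider n p\<^sub>1 p\<^sub>2 p\<^sub>3) (graph_complement G)"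
        by (rule contains_copyD)
      have "f 0 \<in> pverts G"
        using f n5 by (auto simp: embeds_def spider_def graph_of_def graph_complement_def)
      \<comment> \<open>The centre needs \<open>n - 4\<close> neighbours, but the complement has
        degree at most \<open>(m + n - 8) - (m - 3) = n - 5\<close>.\<close>
      moreover have "n - 4 \<le> card (nbhd (graph_complement G) (f 0))"
        using card_nbhd_embeds[OF f pair_graph_complement[OF G(1)] S, of 0] card_nbhd_spider[OF n5 p]
        by simp
      ultimately show False
        using card_nbhd_complement[OF G(1)] deg[of "f 0"] G(2) assms(1) n by simp
    qed
  qed (use assms(1) n G(2) in auto)
  have upper: "contains_copy G T \<or> contains_copy (graph_complement G) (T2 n) \<and>
      contains_copy (graph_complement G) (T3 n) \<and> contains_copy (graph_complement G) (T_sup3 n)"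
    if "pair_graph G" "card (pverts G) = m + n - 6" for G :: "nat pair_pre_digraph"
    using three_trees_in_complement[OF assms(1) n n16 assms(3,4) that] by blast
  have centre_nbrs: "{1, 1, 2} \<subseteq> {1..n - 4}" "{1, 2, 3} \<subseteq> {1..n - 4}"
    "{n - 4, n - 4, n - 4} \<subseteq> {1..n - 4}"
    using assms(1) n by auto
  have "ramsey_number T (T2 n) = m + n - 6"
    unfolding T2_eq_spider using upper by (intro ramsey centre_nbrs) (simp only: T2_eq_spider, blast)
  moreover have "ramsey_number T (T3 n) = m + n - 6"
    unfolding T3_eq_spider using upper by (intro ramsey centre_nbrs) (simp only: T3_eq_spider, blast)
  moreover have "ramsey_number T (T_sup3 n) = m + n - 6"
    unfolding T_sup3_eq_spider using upper by (intro ramsey centre_nbrs) (simp only: T_sup3_eq_spider, blast)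
  ultimately show ?thesis by simp
qed

end
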